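(* Let $A\in\mathbb{R}^{n\times n}$ be symmetric positive definite, let $M\in\mathbb{R}^{n\times n}$ be an (invertible) preconditioner, let $b\in\mathbb{R}^n$, let $x_0\in\mathbb{R}^n$ be an initial guess, and let $m$ be the maximum number of iterations. Let $x_k$ and $r_k$ denote the approximate solutions and residuals generated by the preconditioned conjugate gradient algorithm (PCG) applied to $Ax=b$, and let $\widehat{x}_k$ and $\widehat{r}_k$ denote those generated by the dynamically scaled PCG algorithm (DS-PCG) with scaling factors $\{\omega_k\}_{k=0}^m$, where each $\omega_k\in\mathbb{R}\setminus\{0\}$. Suppose both algorithms use the same $A$, $M$, $b$ and the same initial guess $x_0$ (so $\widehat{x}_0=x_0$). Then, in exact arithmetic, the iterates of DS-PCG and PCG are identical for all $k$ (for which the iterates are generated), that is, $$\widehat{x}_k=x_k\quad\text{and}\quad \widehat{r}_k=r_k .$$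
   Context: All computations are in exact real arithmetic, and $\|\cdot\|$ is the Euclidean norm. PCG. Input: symmetric positive definite $A$, preconditioner $M$, right-hand side $b$, initial guess $x_0$, stopping tolerance $\mathrm{tol}$, maximum number of iterations $m$. Initialize $r_0=b-Ax_0$ and $\beta_{-1}=0$ (so that $p_0=z_0$). For $k=0,1,\dots,m-1$: (1) $z_k=M^{-1}r_k$; (2) $\rho_k=r_k^Tz_k$; (3) if $k>0$, $\beta_{k-1}=\rho_k/\rho_{k-1}$; (4) $p_k=z_k+\beta_{k-1}p_{k-1}$; (5) $q_k=Ap_k$; (6) $\gamma_k=q_k^Tp_k$; (7) $\alpha_k=\rho_k/\gamma_k$; (8) $x_{k+1}=x_k+\alpha_kp_k$; (9) $r_{k+1}=r_k-\alpha_kq_k$; (10) stop if $\|r_{k+1}\|\le \mathrm{tol}\,\|b\|$. DS-PCG. This takes the same input plus scaling factors $\{\omega_k\}_{k=0}^m$, and is identical to PCG except that step (1) is replaced by (1') $y_k=\omega_kr_k$, $z_k=M^{-1}y_k$, with all other steps unchanged (in particular $\rho_k=r_k^Tz_k$ uses the unscaled residual $r_k$). Hats denote the quantities produced by DS-PCG; in particular $\widehat{x}_0=x_0$ and $\widehat{r}_0=b-Ax_0$. Iterates are generated as long as the divisions in steps (3) and (7) are defined and the algorithm has not stopped. *)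

theory Defs
  imports "HOL-Analysis.Analysis"
begin

definition spd :: "real^'n^'n \<Rightarrow> bool" where
  "spd A \<longleftrightarrow> transpose A = A \<and> (\<forall>v. v \<noteq> 0 \<longrightarrow> v \<bullet> (A *v v) > 0)"

text \<open>
  The data available at the start of iteration \<open>k\<close>: \<open>iterate\<close> is \<open>x\<^sub>k\<close>, \<open>residual\<close> is \<open>r\<^sub>k\<close>,
  \<open>prev_dir\<close> is \<open>p\<^bsub>k-1\<^esub>\<close> and \<open>prev_rho\<close> is \<open>\<rho>\<^bsub>k-1\<^esub>\<close>.
\<close>
record 'n cg_state =
  iterate :: "real^'n"
  residual :: "real^'n"
  prev_dir :: "real^'n"
  prev_rho :: real

text \<open>
  Iteration \<open>k\<close>, without the stopping test, for a given rule \<open>prec\<close> computing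
  \<open>z\<^sub>k = prec k r\<^sub>k\<close>, which is the only step in which PCG and DS-PCG differ.
  The result is \<open>None\<close> if the division defining \<open>\<beta>\<^bsub>k-1\<^esub>\<close> (for \<open>k > 0\<close>) or \<open>\<alpha>\<^sub>k\<close> is undefined.
\<close>
definition cg_iteration ::
  "real^'n^'n \<Rightarrow> (nat \<Rightarrow> real^'n \<Rightarrow> real^'n) \<Rightarrow> nat \<Rightarrow> 'n cg_state \<Rightarrow> 'n cg_state option" where
  "cg_iteration A prec k s =
    (let z = prec k (residual s);
         \<rho> = residual s \<bullet> z
     in if k > 0 \<and> prev_rho s = 0 then None
        else
          let \<beta> = (if k > 0 then \<rho> / prev_rho s else 0);
              p = z + \<beta> *\<^sub>R prev_dir s;
              q = A *v p;
              \<gamma> = q \<bullet> p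
          in if \<gamma> = 0 then None
             else
               let \<alpha> = \<rho> / \<gamma>
               in Some \<lparr>iterate = iterate s + \<alpha> *\<^sub>R p,
                        residual = residual s - \<alpha> *\<^sub>R q,
                        prev_dir = p,
                        prev_rho = \<rho>\<rparr>)"

text \<open>
  The state with index \<open>k\<close>, or \<open>None\<close> if it is not generated. The components \<open>prev_dir\<close> and
  \<open>prev_rho\<close> of the initial state are never used, as \<open>\<beta>\<^bsub>-1\<^esub> = 0\<close>. The stopping test closes an
  iteration, so it applies to \<open>r\<^sub>1, r\<^sub>2, \<dots>\<close> but not to \<open>r\<^sub>0\<close>; a residual that passes the
  test is still generated, and only the later ones are not.
\<close>
primrec cg_run ::
  "real^'n^'n \<Rightarrow> (nat \<Rightarrow> real^'n \<Rightarrow> real^'n) \<Rightarrow> real^'n \<Rightarrow> real^'n \<Rightarrow> real \<Rightarrow> nat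
    \<Rightarrow> nat \<Rightarrow> 'n cg_state option" where
  "cg_run A prec b x0 tol m 0 =
     Some \<lparr>iterate = x0, residual = b - A *v x0, prev_dir = 0, prev_rho = 0\<rparr>"
| "cg_run A prec b x0 tol m (Suc k) =
     (case cg_run A prec b x0 tol m k of
        None \<Rightarrow> None
      | Some s \<Rightarrow>
          if k \<ge> m \<or> (k > 0 \<and> norm (residual s) \<le> tol * norm b) then None
          else cg_iteration A prec k s)"

definition pcg ::
  "real^'n^'n \<Rightarrow> real^'n^'n \<Rightarrow> real^'n \<Rightarrow> real^'n \<Rightarrow> real \<Rightarrow> nat \<Rightarrow> nat \<Rightarrow> 'n cg_state option" where
  "pcg A M b x0 tol m = cg_run A (\<lambda>k r. matrix_inv M *v r) b x0 tol m"

definition ds_pcg ::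
  "real^'n^'n \<Rightarrow> real^'n^'n \<Rightarrow> real^'n \<Rightarrow> real^'n \<Rightarrow> real \<Rightarrow> nat \<Rightarrow> (nat \<Rightarrow> real)
    \<Rightarrow> nat \<Rightarrow> 'n cg_state option" where
  "ds_pcg A M b x0 tol m \<omega> = cg_run A (\<lambda>k r. matrix_inv M *v (\<omega> k *\<^sub>R r)) b x0 tol m"

end

theory Submission
  imports Defs
begin

text \<open>
  Scaling \<open>z\<^sub>k\<close> by \<open>\<omega>\<^sub>k\<close> scales \<open>\<rho>\<^sub>k\<close> and \<open>p\<^sub>k\<close> by \<open>\<omega>\<^sub>k\<close>: the factor \<open>\<omega>\<^bsub>k-1\<^esub>\<close> carried by \<open>p\<^bsub>k-1\<^esub>\<close>
  cancels against the one that \<open>\<rho>\<^bsub>k-1\<^esub>\<close> puts into the denominator of \<open>\<beta>\<^bsub>k-1\<^esub>\<close>. Then \<open>\<gamma>\<^sub>k\<close> is scaled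
  by \<open>\<omega>\<^sub>k\<^sup>2\<close> and \<open>\<alpha>\<^sub>k\<close> by \<open>1 / \<omega>\<^sub>k\<close>, so the updates \<open>\<alpha>\<^sub>k p\<^sub>k\<close> and \<open>\<alpha>\<^sub>k q\<^sub>k\<close> do not change.
\<close>

text \<open>This links the two runs: from index 1 on, c is the most recent \<omega>, since earlier
  factors do not accumulate.\<close>

definition scale_direction :: "real \<Rightarrow> 'n::finite cg_state \<Rightarrow> 'n cg_state" where
  "scale_direction c s = s\<lparr>prev_dir := c *\<^sub>R prev_dir s, prev_rho := c * prev_rho s\<rparr>"

lemma scale_direction_simps [simp]:
  "iterate (scale_direction c s) = iterate s"
  "residual (scale_direction c s) = residual s"
  "prev_dir (scale_direction c s) = c *\<^sub>R prev_dir s"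
  "prev_rho (scale_direction c s) = c * prev_rho s"
  by (simp_all add: scale_direction_def)

lemma cg_iteration_scale_direction:
  fixes A :: "real^'n^'n"
  assumes prec: "prec' k (residual s) = w *\<^sub>R prec k (residual s)"
    and "c \<noteq> 0" and "w \<noteq> 0"
  shows "cg_iteration A prec' k (scale_direction c s) =
    map_option (scale_direction w) (cg_iteration A prec k s)"
proof -
  define z where "z = prec k (residual s)"
  define \<rho> where "\<rho> = residual s \<bullet> z"
  define \<beta> where "\<beta> = (if k > 0 then \<rho> / prev_rho s else 0)"
  define p where "p = z + \<beta> *\<^sub>R prev_dir s"
  have \<rho>': "residual s \<bullet> (w *\<^sub>R z) = w * \<rho>"
    by (simp add: \<rho>_def)
  \<comment> \<open>If \<open>prev_rho s = 0\<close>, both quotients are 0 by convention, so no case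
    split is needed.\<close>
  have p': "w *\<^sub>R z + (if k > 0 then w * \<rho> / (c * prev_rho s) else 0) *\<^sub>R c *\<^sub>R prev_dir s = w *\<^sub>R p"
    using \<open>c \<noteq> 0\<close> by (simp add: p_def \<beta>_def scaleR_add_right)
  have q': "A *v (w *\<^sub>R p) = w *\<^sub>R (A *v p)"
    by (rule matrix_vector_mult_scaleR)
  \<comment> \<open>As c and w are nonzero, the breakdown tests on \<open>c * prev_rho s\<close> and
    on \<gamma> scaled by the square of w agree with the unscaled ones.\<close>
  have lhs: "cg_iteration A prec' k (scale_direction c s) =
    (if k > 0 \<and> prev_rho s = 0 \<or> (A *v p) \<bullet> p = 0 then None
     else Some \<lparr>iterate = iterate s + (\<rho> / ((A *v p) \<bullet> p)) *\<^sub>R p,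
                residual = residual s - (\<rho> / ((A *v p) \<bullet> p)) *\<^sub>R (A *v p),
                prev_dir = w *\<^sub>R p, prev_rho = w * \<rho>\<rparr>)"
    unfolding cg_iteration_def Let_def scale_direction_simps prec z_def[symmetric] \<rho>' p' q'
    using \<open>c \<noteq> 0\<close> \<open>w \<noteq> 0\<close> by simp
  have rhs: "cg_iteration A prec k s =
    (if k > 0 \<and> prev_rho s = 0 \<or> (A *v p) \<bullet> p = 0 then None
     else Some \<lparr>iterate = iterate s + (\<rho> / ((A *v p) \<bullet> p)) *\<^sub>R p,
                residual = residual s - (\<rho> / ((A *v p) \<bullet> p)) *\<^sub>R (A *v p),
                prev_dir = p, prev_rho = \<rho>\<rparr>)"
    unfolding cg_iteration_def Let_def z_def[symmetric] \<rho>_def[symmetric] \<beta>_def[symmetric]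
      p_def[symmetric]
    by simp
  show ?thesis
    unfolding lhs rhs by (simp add: scale_direction_def)
qed

lemma cg_run_scale_direction:
  fixes A :: "real^'n^'n"
  assumes "\<And>k r. k < m \<Longrightarrow> prec' k r = \<omega> k *\<^sub>R prec k r"
    and "\<And>k. k < m \<Longrightarrow> \<omega> k \<noteq> 0"
  shows "\<exists>c. c \<noteq> 0 \<and>
    cg_run A prec' b x0 tol m k = map_option (scale_direction c) (cg_run A prec b x0 tol m k)"
proof (induction k)
  case 0
  show ?case
    by (rule exI[of _ 1]) (simp add: scale_direction_def)
next
  case (Suc k)
  then obtain c where "c \<noteq> 0" and
    IH: "cg_run A prec' b x0 tol m k = map_option (scale_direction c) (cg_run A prec b x0 tol m k)"
    by blast
  show ?case
  proof (cases "k < m")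
    case True
    \<comment> \<open>The stopping test reads only the residual, so both runs stop together.\<close>
    have "cg_run A prec' b x0 tol m (Suc k) =
        map_option (scale_direction (\<omega> k)) (cg_run A prec b x0 tol m (Suc k))"
      using cg_iteration_scale_direction[of prec' k _ "\<omega> k" prec c A] assms True \<open>c \<noteq> 0\<close>
      by (simp add: IH split: option.split)
    then show ?thesis
      using assms(2) True by blast
  next
    \<comment> \<open>Both runs are \<open>None\<close> at \<open>Suc k\<close>, so any nonzero
      factor serves; the old c is reused.\<close>
    case False
    then show ?thesis
      using \<open>c \<noteq> 0\<close> by (auto simp: IH split: option.split)
  qed
qed

theorem theorem3p2:
  fixes A M :: "real^'n^'n" and b x0 :: "real^'n"
    and tol :: real and m :: nat and \<omega> :: "nat \<Rightarrow> real"
  assumes "spd A"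
    and "invertible M"
    and "\<forall>k\<le>m. \<omega> k \<noteq> 0"
  shows "\<forall>k. (ds_pcg A M b x0 tol m \<omega> k \<noteq> None \<longleftrightarrow> pcg A M b x0 tol m k \<noteq> None) \<and>
             (\<forall>s' s. ds_pcg A M b x0 tol m \<omega> k = Some s' \<longrightarrow> pcg A M b x0 tol m k = Some s \<longrightarrow>
                iterate s' = iterate s \<and> residual s' = residual s)"
proof
  fix k
  \<comment> \<open>\<open>map_option\<close> preserves \<open>None\<close>, which makes both runs
    equally long.\<close>
  obtain c where "ds_pcg A M b x0 tol m \<omega> k = map_option (scale_direction c) (pcg A M b x0 tol m k)"
    using cg_run_scale_direction[of m "\<lambda>k r. matrix_inv M *v (\<omega> k *\<^sub>R r)" \<omega> "\<lambda>k r. matrix_inv M *v r"]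
      assms(3)
    unfolding ds_pcg_def pcg_def by (force simp: matrix_vector_mult_scaleR)
  then show "(ds_pcg A M b x0 tol m \<omega> k \<noteq> None \<longleftrightarrow> pcg A M b x0 tol m k \<noteq> None) \<and>
             (\<forall>s' s. ds_pcg A M b x0 tol m \<omega> k = Some s' \<longrightarrow> pcg A M b x0 tol m k = Some s \<longrightarrow>
                iterate s' = iterate s \<and> residual s' = residual s)"
    by auto
qed

end
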